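(* Let $n\ge 1$, let $J:=\{j\in\mathbb{Z}_+^N:|j|\le n\}$, and let $\mathcal{M}(n)$ be the moment matrix of an $N$-dimensional real sequence of degree $2n$, with columns $T^j$ indexed by $j\in J$. Let $r:=\operatorname{rank}\mathcal{M}(n)$, and let $\mathcal{B}\equiv\{T^i\}_{i\in I}$ be a maximal linearly independent set of columns of $\mathcal{M}(n)$, where $I\subseteq J$ satisfies $\operatorname{card}I=r$. For each index $j\in J\setminus I$, let $q_j$ denote the unique polynomial in the (real) linear span of $\{t^i\}_{i\in I}$ such that $T^j=q_j(T)$, and let $r_j(t):=t^j-q_j(t)$. Then $\mathcal{V}(\mathcal{M}(n))$ is precisely the set of common zeros (in $\mathbb{R}^N$) of $\{r_j\}_{j\in J\setminus I}$.
   Context: For $i\in\mathbb{Z}_+^N$, $|i|=i_1+\dots+i_N$ and $t^i=t_1^{i_1}\cdots t_N^{i_N}$. Given a real sequence $\beta=\{\beta_i\}_{i\in\mathbb{Z}_+^N,|i|\le 2n}$, its moment matrix $\mathcal{M}(n)=\mathcal{M}(n)(\beta)$ has rows and columns indexed by $J$ with entry $\beta_{i+j}$ in row $i$, column $j$; the column with index $j$ is denoted $T^j$. For a real polynomial $p=\sum_{|i|\le n}a_it^i$, put $p(T):=\sum_{|i|\le n}a_iT^i$. The variety of $\mathcal{M}(n)$ is $\mathcal{V}(\mathcal{M}(n)):=\bigcap\{\mathcal{Z}(p): p\in\mathbb{R}[t_1,\dots,t_N],\ \deg p\le n,\ p(T)=0\}$, where $\mathcal{Z}(p)=\{t\in\mathbb{R}^N:p(t)=0\}$.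 *)

theory Defs
  imports
    "HOL-Analysis.Analysis"
    "HOL-Analysis.Finite_Function_Topology"
    "HOL-Library.Function_Algebras"
begin

instantiation "fun" :: (type, real_vector) real_vector
begin

definition scaleR_fun :: "real \<Rightarrow> ('a \<Rightarrow> 'b) \<Rightarrow> 'a \<Rightarrow> 'b"
  where "scaleR_fun c f = (\<lambda>x. c *\<^sub>R f x)"

instance
  by standard (auto simp: scaleR_fun_def fun_eq_iff scaleR_add_right scaleR_add_left)

end

text \<open>
  Multi-indices with \<open>N\<close> entries are vectors of type \<open>nat ^ 'n\<close> with \<open>N = CARD('n)\<close>.
  A real polynomial in \<open>N\<close> variables is its finitely supported family of coefficients,
  so \<open>Poly_Mapping.single i 1\<close> is the monomial \<open>t\<^sup>i\<close>.
\<close>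

type_synonym 'n rpoly = "(nat ^ 'n) \<Rightarrow>\<^sub>0 real"

definition mi_abs :: "nat ^ 'n::finite \<Rightarrow> nat"
  where "mi_abs i = (\<Sum>k\<in>UNIV. i $ k)"

definition mi_upto :: "nat \<Rightarrow> (nat ^ 'n::finite) set"
  where "mi_upto n = {j. mi_abs j \<le> n}"

definition mi_power :: "real ^ 'n::finite \<Rightarrow> nat ^ 'n \<Rightarrow> real"
  where "mi_power t i = (\<Prod>k\<in>UNIV. (t $ k) ^ (i $ k))"

abbreviation rmonom :: "nat ^ 'n::finite \<Rightarrow> 'n rpoly"
  where "rmonom i \<equiv> Poly_Mapping.single i 1"

text \<open>Total degree, with the convention that the zero polynomial has degree \<open>0\<close>.\<close>

definition rpoly_degree :: "'n::finite rpoly \<Rightarrow> nat"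
  where "rpoly_degree p = Max (insert 0 (mi_abs ` Poly_Mapping.keys p))"

definition rpoly_eval :: "'n::finite rpoly \<Rightarrow> real ^ 'n \<Rightarrow> real"
  where "rpoly_eval p t = (\<Sum>i\<in>Poly_Mapping.keys p. Poly_Mapping.lookup p i * mi_power t i)"

definition rpoly_zeros :: "'n::finite rpoly \<Rightarrow> (real ^ 'n) set"
  where "rpoly_zeros p = {t. rpoly_eval p t = 0}"

text \<open>
  The sequence \<open>\<beta>\<close> is a function on all multi-indices, but only the values at indices
  of absolute value at most \<open>2n\<close> enter. The moment matrix, whose index set depends on \<open>n\<close>,
  is extended by \<open>0\<close> outside its index set; its columns are thus functions supported on
  \<open>mi_upto n\<close>, with the same linear relations as the columns of the finite matrix.
\<close>

definition moment_matrix :: "(nat ^ 'n::finite \<Rightarrow> real) \<Rightarrow> nat \<Rightarrow> nat ^ 'n \<Rightarrow> nat ^ 'n \<Rightarrow> real"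
  where "moment_matrix \<beta> n i j = (if i \<in> mi_upto n \<and> j \<in> mi_upto n then \<beta> (i + j) else 0)"

definition moment_column :: "(nat ^ 'n::finite \<Rightarrow> real) \<Rightarrow> nat \<Rightarrow> nat ^ 'n \<Rightarrow> nat ^ 'n \<Rightarrow> real"
  where "moment_column \<beta> n j = (\<lambda>i. moment_matrix \<beta> n i j)"

definition moment_rank :: "(nat ^ 'n::finite \<Rightarrow> real) \<Rightarrow> nat \<Rightarrow> nat"
  where "moment_rank \<beta> n = dim (span (moment_column \<beta> n ` mi_upto n))"

text \<open>The column \<open>p(T)\<close>, meaningful for polynomials of degree at most \<open>n\<close>.\<close>

definition column_poly ::
    "(nat ^ 'n::finite \<Rightarrow> real) \<Rightarrow> nat \<Rightarrow> 'n rpoly \<Rightarrow> nat ^ 'n \<Rightarrow> real"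
  where "column_poly \<beta> n p =
    (\<Sum>i\<in>mi_upto n. Poly_Mapping.lookup p i *\<^sub>R moment_column \<beta> n i)"

definition moment_variety :: "(nat ^ 'n::finite \<Rightarrow> real) \<Rightarrow> nat \<Rightarrow> (real ^ 'n) set"
  where "moment_variety \<beta> n =
    \<Inter> {rpoly_zeros p | p. rpoly_degree p \<le> n \<and> column_poly \<beta> n p = 0}"

definition is_column_rep ::
    "(nat ^ 'n::finite \<Rightarrow> real) \<Rightarrow> nat \<Rightarrow> (nat ^ 'n) set \<Rightarrow> nat ^ 'n \<Rightarrow> 'n rpoly \<Rightarrow> bool"
  where "is_column_rep \<beta> n I j q \<longleftrightarrow>
    q \<in> span (rmonom ` I) \<and> moment_column \<beta> n j = column_poly \<beta> n q"

definition column_rep ::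
    "(nat ^ 'n::finite \<Rightarrow> real) \<Rightarrow> nat \<Rightarrow> (nat ^ 'n) set \<Rightarrow> nat ^ 'n \<Rightarrow> 'n rpoly"
  where "column_rep \<beta> n I j = (THE q. is_column_rep \<beta> n I j q)"

definition column_relation ::
    "(nat ^ 'n::finite \<Rightarrow> real) \<Rightarrow> nat \<Rightarrow> (nat ^ 'n) set \<Rightarrow> nat ^ 'n \<Rightarrow> 'n rpoly"
  where "column_relation \<beta> n I j = rmonom j - column_rep \<beta> n I j"

definition maximal_independent_in :: "'a::real_vector set \<Rightarrow> 'a set \<Rightarrow> bool"
  where "maximal_independent_in B S \<longleftrightarrow>
    B \<subseteq> S \<and> independent B \<and> (\<forall>B'. B \<subset> B' \<and> B' \<subseteq> S \<longrightarrow> dependent B')"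

end

theory Submission
  imports Defs
begin

text \<open>
  Since \<open>\<B>\<close> has \<open>r\<close> elements indexed by \<open>r\<close> indices, \<open>p \<mapsto> p(T)\<close> is injective on the span
  of \<open>{t\<^sup>i}\<^bsub>i\<in>I\<^esub>\<close>, and by maximality it maps this span onto the column space. Any \<open>p\<close> of degree
  at most \<open>n\<close> is therefore a combination of the \<open>r\<^sub>j\<close> plus some \<open>s\<close> in this span; if
  \<open>p(T) = 0\<close> then \<open>s(T) = 0\<close>, so \<open>s = 0\<close>, and \<open>p\<close> vanishes wherever all \<open>r\<^sub>j\<close> do.
\<close>

lemma finite_mi_upto: "finite (mi_upto n :: (nat ^ 'n::finite) set)"
proof -
  have "j $ k \<le> n" if "mi_abs j \<le> n" for j :: "nat ^ 'n" and k
    using that member_le_sum[of k UNIV "\<lambda>k. j $ k"] by (simp add: mi_abs_def)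
  \<comment> \<open>Each entry is bounded by \<open>n\<close>, so the indices, viewed as functions,
    lie in a finite product of finite sets.\<close>
  then have "vec_nth ` (mi_upto n :: (nat ^ 'n) set) \<subseteq> PiE UNIV (\<lambda>_. {..n})"
    by (auto simp: mi_upto_def)
  then have "finite (vec_nth ` (mi_upto n :: (nat ^ 'n) set))"
    by (rule finite_subset) (simp add: finite_PiE)
  then show ?thesis
    by (rule finite_imageD) (simp add: inj_on_def vec_eq_iff fun_eq_iff)
qed

lemma rpoly_degree_le_iff: "rpoly_degree p \<le> n \<longleftrightarrow> Poly_Mapping.keys p \<subseteq> mi_upto n"
  by (auto simp: rpoly_degree_def mi_upto_def)

lemma lookup_scaleR:
  "Poly_Mapping.lookup (c *\<^sub>R p) i = c *\<^sub>R Poly_Mapping.lookup (p :: 'a \<Rightarrow>\<^sub>0 'b::real_vector) i"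
proof -
  have "finite {i. c *\<^sub>R Poly_Mapping.lookup p i \<noteq> 0}"
    by (rule finite_subset[OF _ finite_keys[of p]]) (auto simp: in_keys_iff)
  then show ?thesis
    by (simp add: scaleR_poly_mapping_def)
qed

lemma rpoly_eval_superset:
  assumes "finite A" "Poly_Mapping.keys p \<subseteq> A"
  shows "rpoly_eval p t = (\<Sum>i\<in>A. Poly_Mapping.lookup p i * mi_power t i)"
  unfolding rpoly_eval_def using assms
  by (intro sum.mono_neutral_left) (auto simp: in_keys_iff)

lemma linear_rpoly_eval: "linear (\<lambda>p. rpoly_eval p t)"
proof (rule linearI)
  fix p q :: "'a rpoly" and c :: real
  \<comment> \<open>Cancellation or a zero scalar can shrink the support, so all evaluations are
    taken over one common finite set of indices.\<close>
  let ?A = "Poly_Mapping.keys p \<union> Poly_Mapping.keys q"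
  have "finite ?A" by simp
  note eval = rpoly_eval_superset[OF this, of _ t]
  show "rpoly_eval (p + q) t = rpoly_eval p t + rpoly_eval q t"
    using keys_add[of p q]
    by (simp add: eval lookup_add sum.distrib algebra_simps)
  have "Poly_Mapping.keys (c *\<^sub>R p) \<subseteq> ?A"
    by (auto simp: in_keys_iff lookup_scaleR)
  then show "rpoly_eval (c *\<^sub>R p) t = c *\<^sub>R rpoly_eval p t"
    by (simp add: eval lookup_scaleR sum_distrib_left mult.assoc)
qed

lemma linear_column_poly: "linear (column_poly \<beta> n)"
  by (rule linearI)
    (simp_all add: column_poly_def lookup_add lookup_scaleR scaleR_add_left sum.distrib
      scaleR_sum_right)

lemma column_poly_rmonom:
  assumes "i \<in> mi_upto n"
  shows "column_poly \<beta> n (rmonom i) = moment_column \<beta> n i"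
proof -
  have "column_poly \<beta> n (rmonom i) = (\<Sum>j\<in>mi_upto n. if j = i then moment_column \<beta> n j else 0)"
    unfolding column_poly_def by (rule sum.cong) (auto simp: lookup_single when_def)
  then show ?thesis
    using assms by (simp add: finite_mi_upto)
qed

lemma rpoly_eq_sum_rmonom:
  assumes "finite A" "Poly_Mapping.keys p \<subseteq> A"
  shows "p = (\<Sum>i\<in>A. Poly_Mapping.lookup p i *\<^sub>R rmonom i)"
proof (rule poly_mapping_eqI)
  fix k
  have "(\<Sum>i\<in>A. Poly_Mapping.lookup (Poly_Mapping.lookup p i *\<^sub>R rmonom i) k) =
      (\<Sum>i\<in>A. if i = k then Poly_Mapping.lookup p i else 0)"
    by (rule sum.cong) (auto simp: lookup_scaleR lookup_single when_def)
  also have "\<dots> = Poly_Mapping.lookup p k"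
    using assms by (auto simp: in_keys_iff)
  finally show "Poly_Mapping.lookup p k =
      Poly_Mapping.lookup (\<Sum>i\<in>A. Poly_Mapping.lookup p i *\<^sub>R rmonom i) k"
    by (simp add: lookup_sum)
qed

text \<open>Polynomials supported in \<open>A\<close> form a subspace that contains the monomials.
  This later bounds the degree of each \<open>column_rep\<close>.\<close>

lemma keys_subset_if_in_span_rmonom:
  assumes "q \<in> span (rmonom ` A)"
  shows "Poly_Mapping.keys q \<subseteq> A"
proof -
  have "subspace {p :: 'a rpoly. Poly_Mapping.keys p \<subseteq> A}"
    unfolding subspace_def
  proof (intro conjI ballI allI; clarsimp)
    fix p q :: "'a rpoly" and k
    assume "Poly_Mapping.keys p \<subseteq> A" "Poly_Mapping.keys q \<subseteq> A" "k \<in> Poly_Mapping.keys (p + q)"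
    then show "k \<in> A" using keys_add[of p q] by auto
  next
    fix p :: "'a rpoly" and c k
    assume "Poly_Mapping.keys p \<subseteq> A" "k \<in> Poly_Mapping.keys (c *\<^sub>R p)"
    then show "k \<in> A" by (auto simp: in_keys_iff lookup_scaleR)
  qed
  then have "span (rmonom ` A) \<subseteq> {p. Poly_Mapping.keys p \<subseteq> A}"
    by (intro span_minimal) auto
  with assms show ?thesis by auto
qed

lemma mem_moment_variety_iff:
  "t \<in> moment_variety \<beta> n \<longleftrightarrow>
    (\<forall>p. rpoly_degree p \<le> n \<and> column_poly \<beta> n p = 0 \<longrightarrow> rpoly_eval p t = 0)"
  unfolding moment_variety_def rpoly_zeros_def by blast

text \<open>An element of \<open>S\<close> outside \<open>span B\<close> could be adjoined to
  \<open>B\<close> without losing independence, against maximality.\<close>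

lemma maximal_independent_in_span:
  assumes "maximal_independent_in B S"
  shows "S \<subseteq> span B"
proof
  fix x assume "x \<in> S"
  show "x \<in> span B"
  proof (rule ccontr)
    assume x: "x \<notin> span B"
    then have "x \<notin> B" using span_base by blast
    with x \<open>x \<in> S\<close> assms show False
      unfolding maximal_independent_in_def
      by (metis independent_insertI insert_subset psubsetI subset_insertI insertI1)
  qed
qed

theorem proposition1p3:
  fixes \<beta> :: "nat ^ 'n::finite \<Rightarrow> real" and n :: nat and I :: "(nat ^ 'n) set"
  assumes "n \<ge> 1"
    and "I \<subseteq> mi_upto n"
    and "card I = moment_rank \<beta> n"
    and "maximal_independent_in (moment_column \<beta> n ` I) (moment_column \<beta> n ` mi_upto n)"
  shows "(\<forall>j\<in>mi_upto n - I. \<exists>!q. is_column_rep \<beta> n I j q) \<and>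
    moment_variety \<beta> n =
      {t. \<forall>j\<in>mi_upto n - I. rpoly_eval (column_relation \<beta> n I j) t = 0}"
proof -
  let ?C = "moment_column \<beta> n" and ?P = "column_poly \<beta> n" and ?S = "span (rmonom ` I)"
  interpret P: linear ?P by (rule linear_column_poly)
  have ind: "independent (?C ` I)"
    using assms(4) by (simp add: maximal_independent_in_def)
  have spn: "?C ` mi_upto n \<subseteq> span (?C ` I)"
    using assms(4) by (rule maximal_independent_in_span)
  have "span (?C ` mi_upto n) = span (?C ` I)"
    using spn assms(2) by (metis image_mono span_eq span_superset subset_trans)
  \<comment> \<open>Independence of the image as a set does not exclude equal columns at two indices
    of \<open>I\<close>; comparing cardinalities with the rank does.\<close>
  then have "card (?C ` I) = card I"
    using assms(3) dim_span_eq_card_independent[OF ind] by (simp add: moment_rank_def)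
  then have injC: "inj_on ?C I"
    using assms(2) finite_mi_upto finite_subset eq_card_imp_inj_on by metis
  have PC: "?P (rmonom i) = ?C i" if "i \<in> I" for i
    using that assms(2) by (auto intro: column_poly_rmonom)
  then have img: "?P ` rmonom ` I = ?C ` I"
    by (simp add: image_image)
  have "inj_on ?P (rmonom ` I)"
    using injC PC by (auto simp: inj_on_def)
  \<comment> \<open>A linear map that is injective on a set and has independent image there is
    injective on the span of that set.\<close>
  then have injP: "inj_on ?P ?S"
    using ind img linear_inj_on_span_independent_image[OF linear_column_poly] by metis
  \<comment> \<open>Existence: \<open>?P\<close> maps \<open>?S\<close> onto the span of the chosen
    columns, which contains every column. Uniqueness is \<open>injP\<close>. Indices in
    \<open>I\<close> are included, so that later sums can run over all of
    \<open>mi_upto n\<close>.\<close>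
  have ex1: "\<exists>!q. is_column_rep \<beta> n I j q" if "j \<in> mi_upto n" for j
  proof -
    have "?C j \<in> ?P ` ?S"
      using that spn img linear_span_image[OF linear_column_poly, of \<beta> n "rmonom ` I"] by auto
    then show ?thesis
      using injP by (auto simp: is_column_rep_def inj_on_def)
  qed
  have rep: "is_column_rep \<beta> n I j (column_rep \<beta> n I j)" if "j \<in> mi_upto n" for j
    unfolding column_rep_def by (rule theI') (rule ex1[OF that])
  have rel: "?P (column_relation \<beta> n I j) = 0" if "j \<in> mi_upto n" for j
    using rep[OF that] column_poly_rmonom[OF that, of \<beta>]
    by (simp add: column_relation_def is_column_rep_def P.diff)
  \<comment> \<open>For \<open>j\<close> in \<open>I\<close> the monomial represents its own column,
    so by uniqueness it is \<open>column_rep \<beta> n I j\<close>.\<close>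
  have rel0: "column_relation \<beta> n I j = 0" if "j \<in> I" for j
  proof -
    have "j \<in> mi_upto n" using that assms(2) by auto
    moreover have "is_column_rep \<beta> n I j (rmonom j)"
      using that PC by (auto simp: is_column_rep_def intro: span_base)
    ultimately show ?thesis
      using ex1 rep unfolding column_relation_def by (metis right_minus_eq)
  qed
  have deg: "rpoly_degree (column_relation \<beta> n I j) \<le> n" if "j \<in> mi_upto n" for j
  proof -
    have "Poly_Mapping.keys (column_rep \<beta> n I j) \<subseteq> I"
      using rep[OF that] keys_subset_if_in_span_rmonom by (auto simp: is_column_rep_def)
    then show ?thesis
      using that assms(2) keys_diff[of "rmonom j :: 'n rpoly" "column_rep \<beta> n I j"]
      by (auto simp: rpoly_degree_le_iff column_relation_def)
  qed
  have vanish: "rpoly_eval p t = 0"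
    if t: "\<forall>j\<in>mi_upto n - I. rpoly_eval (column_relation \<beta> n I j) t = 0"
      and p: "rpoly_degree p \<le> n" "?P p = 0" for p t
  proof -
    interpret E: linear "\<lambda>p. rpoly_eval p t" by (rule linear_rpoly_eval)
    \<comment> \<open>Expanding \<open>p\<close> in monomials and writing each monomial as
      \<open>column_relation\<close> plus \<open>column_rep\<close> splits \<open>p\<close> into
      \<open>d + s\<close>.\<close>
    define s where "s = (\<Sum>j\<in>mi_upto n. Poly_Mapping.lookup p j *\<^sub>R column_rep \<beta> n I j)"
    define d where "d = (\<Sum>j\<in>mi_upto n. Poly_Mapping.lookup p j *\<^sub>R column_relation \<beta> n I j)"
    have "p = (\<Sum>j\<in>mi_upto n. Poly_Mapping.lookup p j *\<^sub>R rmonom j)"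
      using p(1) finite_mi_upto rpoly_degree_le_iff by (intro rpoly_eq_sum_rmonom) auto
    also have "\<dots> = d + s"
      by (simp add: d_def s_def column_relation_def scaleR_diff_right flip: sum.distrib)
    finally have pds: "p = d + s" .
    have "?P d = 0"
      by (simp add: d_def P.sum P.scale rel)
    then have "?P s = ?P 0"
      using p(2) by (simp add: pds P.add P.zero)
    moreover have "s \<in> ?S"
      using rep by (auto simp: s_def is_column_rep_def intro!: span_sum span_scale)
    ultimately have "s = 0"
      using injP by (auto simp: inj_on_def span_zero)
    \<comment> \<open>The assumption on \<open>t\<close> covers only indices outside
      \<open>I\<close>; for the others the relation is the zero polynomial.\<close>
    have "rpoly_eval (column_relation \<beta> n I j) t = 0" if "j \<in> mi_upto n" for j
      using that t rel0 E.zero by (cases "j \<in> I") auto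
    then have "rpoly_eval d t = 0"
      by (simp add: d_def E.sum E.scale)
    then show ?thesis
      by (simp add: pds \<open>s = 0\<close>)
  qed
  \<comment> \<open>By \<open>deg\<close> and \<open>rel\<close> each relation is among the
    polynomials that cut out the variety, which gives one inclusion; \<open>vanish\<close> gives the
    other.\<close>
  have "moment_variety \<beta> n =
      {t. \<forall>j\<in>mi_upto n - I. rpoly_eval (column_relation \<beta> n I j) t = 0}"
    using vanish rel deg by (auto simp: mem_moment_variety_iff)
  then show ?thesis
    using ex1 by auto
qed

end
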